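(* Let $X=(X_n)_{n\in\mathbb{Z}}$ be the i.i.d. increments of a skip-free to the left random walk, let $\mathbb{Z}^R$ be the record graph of $(\mathbb{Z},X)$ and let $[\mathbf{T},0]$ be the connected component of $0$ (rooted at $0$) in $\mathbb{Z}^R$. If $\mathbb{E}[X_0]=0$, then almost surely the record graph $\mathbb{Z}^R$ is connected and the unimodular Family Tree $[\mathbf{T},0]$ is of class $\mathcal{I}/\mathcal{I}$.
   Context: **Increments.** "I.i.d. increments of a skip-free to the left random walk" means: $X=(X_n)_{n\in\mathbb{Z}}$ is i.i.d., each $X_n$ takes values in $\{-1,0,1,2,\dots\}$, $\mathbb{P}[X_0=-1]>0$ and $\mathbb{E}[X_0]<\infty$. **Record graph.** For an integer-valued sequence $x$ the record map is $R_x(i)=\inf\{j>i:\sum_{l=i}^{j-1}x_l\ge 0\}$ if the infimum exists and $R_x(i)=i$ otherwise. The record graph of $(\mathbb{Z},x)$ is the directed graph on $\mathbb{Z}$ with edges $(i,R_x(i))$ for all $i$ with $R_x(i)\ne i$; "connected" refers to the underlying undirected graph. **Class $\mathcal{I}/\mathcal{I}$.** In a Family Tree (locally finite directed tree with out-degrees at most $1$), let $F$ map each vertex to its parent (the endpoint of its outgoing edge) if it exists, and to itself otherwise. The foil of a vertex $u$ is $\{v: F^n(v)=F^n(u)\text{ for some }n\ge0\}$. The tree is of class $\mathcal{I}/\mathcal{I}$ if it is infinite and all its foils are infinite. For unimodular Family Trees this is (known to be) equivalent to: the tree is eternal (every vertex has a parent), one-ended, and each vertex has finitely many descendants. (The tree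 $[\mathbf{T},0]$ is unimodular, i.e. satisfies the Mass Transport Principle; this is known because $X$ is stationary.) *)

theory Defs
  imports
    "HOL-Probability.Probability"
    "Graph_Theory.Digraph_Component"
begin

definition (in prob_space) skip_free_left_increments :: "(int \<Rightarrow> 'a \<Rightarrow> int) \<Rightarrow> bool" where
  "skip_free_left_increments X \<longleftrightarrow>
     indep_vars (\<lambda>_. count_space UNIV) X UNIV \<and>
     (\<forall>n. distr M (count_space UNIV) (X n) = distr M (count_space UNIV) (X 0)) \<and>
     (\<forall>n. \<forall>\<omega>\<in>space M. X n \<omega> \<ge> -1) \<and>
     prob {\<omega> \<in> space M. X 0 \<omega> = -1} > 0 \<and>
     integrable M (\<lambda>\<omega>. real_of_int (X 0 \<omega>))"

text \<open>The set below is bounded from below by \<open>i\<close>, so its infimum in the integers is attained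
  whenever the set is nonempty.\<close>

definition record_map :: "(int \<Rightarrow> int) \<Rightarrow> int \<Rightarrow> int" where
  "record_map x i =
     (let J = {j. i < j \<and> (\<Sum>l\<in>{i..<j}. x l) \<ge> 0}
      in if J = {} then i else Inf J)"

definition record_graph :: "(int \<Rightarrow> int) \<Rightarrow> (int, int \<times> int) pre_digraph" where
  "record_graph x =
     \<lparr>verts = UNIV, arcs = {(i, record_map x i) | i. record_map x i \<noteq> i}, tail = fst, head = snd\<rparr>"

text \<open>Connected component with respect to the underlying undirected graph, as a directed graph.\<close>

definition weak_component :: "('v, 'e) pre_digraph \<Rightarrow> 'v \<Rightarrow> ('v, 'e) pre_digraph" where
  "weak_component G u = G \<restriction> {v. u \<rightarrow>\<^sup>*\<^bsub>with_proj (mk_symmetric G)\<^esub> v}"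

text \<open>A directed tree is an orientation of an undirected tree. The library predicate
  \<^const>\<open>tree\<close> is not used because it only excludes directed cycles. In
  \<^term>\<open>mk_symmetric G\<close> an undirected edge is a pair of opposite arcs, which form a cycle of
  length 2; a cycle of length 1 is a loop, and the cycles of length at least 3 are those of the
  underlying undirected graph.\<close>

definition directed_tree :: "('v, 'e) pre_digraph \<Rightarrow> bool" where
  "directed_tree G \<longleftrightarrow>
     nomulti_digraph G \<and> asym (arcs_ends G) \<and>
     Digraph_Component.connected G \<and>
     (\<forall>p. pre_digraph.cycle (with_proj (mk_symmetric G)) p \<longrightarrow> length p = 2)"

definition locally_finite_digraph :: "('v, 'e) pre_digraph \<Rightarrow> bool" where
  "locally_finite_digraph G \<longleftrightarrow>
     (\<forall>v\<in>verts G. finite (in_arcs G v) \<and> finite (out_arcs G v))"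

definition family_tree :: "('v, 'e) pre_digraph \<Rightarrow> bool" where
  "family_tree G \<longleftrightarrow>
     directed_tree G \<and> locally_finite_digraph G \<and> (\<forall>v\<in>verts G. out_degree G v \<le> 1)"

definition parent :: "('v, 'e) pre_digraph \<Rightarrow> 'v \<Rightarrow> 'v" where
  "parent G u = (if \<exists>v. u \<rightarrow>\<^bsub>G\<^esub> v then THE v. u \<rightarrow>\<^bsub>G\<^esub> v else u)"

definition foil :: "('v, 'e) pre_digraph \<Rightarrow> 'v \<Rightarrow> 'v set" where
  "foil G u = {v \<in> verts G. \<exists>n. (parent G ^^ n) v = (parent G ^^ n) u}"

definition class_I_I :: "('v, 'e) pre_digraph \<Rightarrow> bool" where
  "class_I_I G \<longleftrightarrow> infinite (verts G) \<and> (\<forall>u\<in>verts G. infinite (foil G u))"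

end

theory Submission
  imports Defs
begin

text \<open>
  If every integer has a record, then the record graph is connected, because record edges do not
  cross. Every vertex \<open>j\<close> has finitely many descendants as soon as the walk exceeds its value at
  \<open>j\<close> somewhere before \<open>j\<close>. The latter holds almost surely because a bounded nonnegative function
  that vanishes on the nonpositive integers and is harmonic for the walk on the positive integers
  is zero, by a maximum principle. It implies that \<open>0\<close> has \<open>x (-1) + 1\<close> children, and since the
  expected number of children of \<open>0\<close> is the probability that \<open>0\<close> has a parent, every vertex has a
  parent almost surely. Finally, if some foil were finite, then the tree would have a finite first
  generation, whose least element would be a shift-equivariant random integer; by stationarity there
  is none.
\<close>

section \<open>Records of a height function\<close>

text \<open>The walk with increments \<open>x\<close>, pinned at time \<open>0\<close> and extended
  to negative times. Partial sums become height differences, so records become comparisons of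
  heights.\<close>

definition height :: "(int \<Rightarrow> int) \<Rightarrow> int \<Rightarrow> int" where
  "height x n = (if 0 \<le> n then \<Sum>l\<in>{0..<n}. x l else - (\<Sum>l\<in>{n..<0}. x l))"

lemma height_0 [simp]: "height x 0 = 0"
  by (simp add: height_def)

lemma height_add1: "height x (n + 1) = height x n + x n"
proof (cases "0 \<le> n")
  case True
  have "{0..<n + 1} = insert n {0..<n}" using True by auto
  then show ?thesis using True by (simp add: height_def)
next
  case False
  then have "{n..<0} = insert n {n + 1..<0}" by auto
  then have "(\<Sum>l\<in>{n..<0}. x l) = x n + (\<Sum>l\<in>{n + 1..<0}. x l)" by simp
  moreover have "height x (n + 1) = - (\<Sum>l\<in>{n + 1..<0}. x l)"
    using False by (cases "n = -1") (simp_all add: height_def)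
  ultimately show ?thesis using False by (simp add: height_def)
qed

lemma sum_eq_height_diff:
  assumes "i \<le> j"
  shows "(\<Sum>l\<in>{i..<j}. x l) = height x j - height x i"
  using assms
proof (induction j rule: int_ge_induct)
  case base
  show ?case by simp
next
  case (step j)
  have "{i..<j + 1} = insert j {i..<j}" using step.hyps by auto
  then show ?case using step by (simp add: height_add1)
qed

lemma record_map_eqI:
  assumes "i < j" "height x i \<le> height x j"
    and "\<And>k. i < k \<Longrightarrow> k < j \<Longrightarrow> height x k < height x i"
  shows "record_map x i = j"
proof -
  let ?J = "{j. i < j \<and> (\<Sum>l\<in>{i..<j}. x l) \<ge> 0}"
  have "j \<in> ?J" using assms(1,2) by (simp add: sum_eq_height_diff)
  moreover have "j \<le> k" if "k \<in> ?J" for k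
    using that assms(3)[of k] by (force simp: sum_eq_height_diff not_less)
  ultimately have "Inf ?J = j" by (intro cInf_eq_minimum) auto
  moreover have "?J \<noteq> {}" using \<open>j \<in> ?J\<close> by blast
  ultimately show ?thesis unfolding record_map_def Let_def by presburger
qed

lemma record_map_eq_self:
  assumes "\<And>j. i < j \<Longrightarrow> height x j < height x i"
  shows "record_map x i = i"
proof -
  have "{j. i < j \<and> (\<Sum>l\<in>{i..<j}. x l) \<ge> 0} = {}"
    using assms by (force simp: sum_eq_height_diff)
  then show ?thesis unfolding record_map_def Let_def by presburger
qed

text \<open>Up to any time \<open>j\<close> at least as high as \<open>i\<close> there are only
  finitely many candidates, so a least one exists and the infimum is attained.\<close>

lemma record_map_cases:
  obtains (none) "record_map x i = i" "\<And>j. i < j \<Longrightarrow> height x j < height x i"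
  | (exists_record) "i < record_map x i" "height x i \<le> height x (record_map x i)"
      "\<And>k. i < k \<Longrightarrow> k < record_map x i \<Longrightarrow> height x k < height x i"
proof (cases "\<exists>j>i. height x i \<le> height x j")
  case False
  then show thesis using none record_map_eq_self[of i x] by (meson not_le)
next
  case True
  then obtain j where j: "i < j" "height x i \<le> height x j" by auto
  let ?K = "{k \<in> {i<..j}. height x i \<le> height x k}"
  have "finite ?K" by (rule finite_subset[of _ "{i<..j}"]) auto
  moreover have "j \<in> ?K" using j by simp
  ultimately have K: "finite ?K" "j \<in> ?K" .
  then have Min: "Min ?K \<in> ?K" by (intro Min_in) auto
  have less: "height x k < height x i" if "i < k" "k < Min ?K" for k
  proof (rule ccontr)
    assume "\<not> height x k < height x i"
    moreover have "k \<le> j" using that(2) Min_le[OF K] by simp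
    ultimately have "k \<in> ?K" using that(1) by simp
    then show False using Min_le[OF K(1), of k] that(2) by simp
  qed
  have "record_map x i = Min ?K"
    using Min less by (intro record_map_eqI) auto
  then show thesis using exists_record Min less by auto
qed

text \<open>A form free of infima, built from comparisons of heights quantified over integers;
  measurability of \<open>record_map\<close> follows from it.\<close>

lemma record_map_eq_iff:
  "record_map x i = j \<longleftrightarrow>
     (i = j \<and> (\<forall>k. i < k \<longrightarrow> height x k < height x i)) \<or>
     (i < j \<and> height x i \<le> height x j \<and> (\<forall>k. i < k \<longrightarrow> k < j \<longrightarrow> height x k < height x i))"
  (is "_ \<longleftrightarrow> ?R j")
proof
  assume "record_map x i = j"
  then show "?R j"
  proof (cases x i rule: record_map_cases)
    case none
    then show ?thesis using \<open>record_map x i = j\<close> by simp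
  next
    case exists_record
    then show ?thesis using \<open>record_map x i = j\<close> by simp
  qed
next
  assume "?R j"
  then show "record_map x i = j"
  proof (elim disjE conjE)
    assume "i = j" "\<forall>k. i < k \<longrightarrow> height x k < height x i"
    then show ?thesis using record_map_eq_self[of i x] by simp
  next
    assume "i < j" "height x i \<le> height x j" "\<forall>k. i < k \<longrightarrow> k < j \<longrightarrow> height x k < height x i"
    then show ?thesis by (intro record_map_eqI) simp_all
  qed
qed

lemma record_map_gt:
  assumes "record_map x i \<noteq> i"
  shows "i < record_map x i"
  using assms by (cases x i rule: record_map_cases) auto

text \<open>Heights do not decrease along a chain of records, and the times skipped by an edge lie
  below its start; so each ancestor is a running maximum.\<close>

lemma height_le_of_funpow_record_map:
  assumes "(record_map x ^^ n) i = j"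
  shows "i \<le> j \<and> (\<forall>k\<in>{i..j}. height x k \<le> height x j)"
  using assms
proof (induction n arbitrary: j)
  case 0
  then show ?case by auto
next
  case (Suc n)
  define l where "l = (record_map x ^^ n) i"
  have l: "i \<le> l" "\<And>k. k \<in> {i..l} \<Longrightarrow> height x k \<le> height x l"
    using Suc.IH[of l] l_def by auto
  have j: "j = record_map x l" using Suc.prems l_def by simp
  show ?case
  proof (cases x l rule: record_map_cases)
    case none
    then show ?thesis using l j by auto
  next
    case exists_record
    have "height x k \<le> height x j" if k: "k \<in> {i..j}" for k
    proof -
      consider "k \<le> l" | "l < k" "k < j" | "k = j" using k by force
      then show ?thesis
      proof cases
        case 1
        then show ?thesis using l(2)[of k] k exists_record(2) j by auto
      next
        case 2
        then show ?thesis using exists_record(2,3) j by fastforce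
      qed simp
    qed
    then show ?thesis using l(1) exists_record(1) j by auto
  qed
qed

text \<open>The time \<open>k\<close> is a barrier: an ancestor is maximal on the range from its
  descendant, so no vertex before \<open>k\<close> descends from \<open>j\<close>.\<close>

lemma finite_descendants:
  assumes "k < j" "height x j < height x k"
  shows "finite {i. \<exists>n. (record_map x ^^ n) i = j}"
proof (rule finite_subset)
  show "{i. \<exists>n. (record_map x ^^ n) i = j} \<subseteq> {k..j}"
  proof clarify
    fix i n assume "j = (record_map x ^^ n) i"
    then have *: "i \<le> j" "\<And>k. k \<in> {i..j} \<Longrightarrow> height x k \<le> height x j"
      using height_le_of_funpow_record_map[of n x i j] by auto
    have "k \<le> i" using *(2)[of k] assms by force
    then show "i \<in> {k..(record_map x ^^ n) i}" using *(1) \<open>j = _\<close> by simp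
  qed
qed simp

text \<open>Record edges do not cross: a vertex strictly between \<open>i\<close> and \<open>R i\<close> lies below the level of
  \<open>i\<close>, hence its own record is at most \<open>R i\<close>.\<close>

lemma record_map_noncrossing:
  assumes total: "\<And>i. record_map x i \<noteq> i"
    and "i < j" "j \<le> record_map x i"
  shows "\<exists>n. (record_map x ^^ n) j = record_map x i"
  using assms(2,3)
proof (induction "nat (record_map x i - j)" arbitrary: j rule: less_induct)
  case less
  show ?case
  proof (cases "j = record_map x i")
    case True
    then show ?thesis by (intro exI[of _ 0]) simp
  next
    case False
    have i: "height x i \<le> height x (record_map x i)"
        "\<And>k. i < k \<Longrightarrow> k < record_map x i \<Longrightarrow> height x k < height x i"
      using total[of i] by (cases x i rule: record_map_cases; auto)+
    have j: "j < record_map x j"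
        "\<And>k. j < k \<Longrightarrow> k < record_map x j \<Longrightarrow> height x k < height x j"
      using total[of j] by (cases x j rule: record_map_cases; auto)+
    have "record_map x j \<le> record_map x i"
      using j(2)[of "record_map x i"] i(1) i(2)[of j] less.prems False by force
    then obtain n where "(record_map x ^^ n) (record_map x j) = record_map x i"
      using less.hyps[of "record_map x j"] less.prems False j(1) by auto
    then show ?thesis by (intro exI[of _ "Suc n"]) (simp add: funpow_swap1)
  qed
qed

text \<open>The chain from \<open>i\<close> climbs until an edge reaches or jumps over
  \<open>j\<close>; by noncrossing its endpoint lies on the chain from \<open>j\<close>.\<close>

lemma common_ancestor_le:
  assumes total: "\<And>i. record_map x i \<noteq> i"
    and "i \<le> j"
  shows "\<exists>m n. (record_map x ^^ m) i = (record_map x ^^ n) j"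
  using assms(2)
proof (induction "nat (j - i)" arbitrary: i rule: less_induct)
  case less
  have i: "i < record_map x i" using total record_map_gt by blast
  consider "i = j" | "i < j" "record_map x i \<le> j" | "i < j" "j \<le> record_map x i"
    using less.prems by linarith
  then show ?case
  proof cases
    case 1
    then show ?thesis by blast
  next
    case 2
    then obtain m n where "(record_map x ^^ m) (record_map x i) = (record_map x ^^ n) j"
      using less.hyps[of "record_map x i"] i by auto
    then have "(record_map x ^^ Suc m) i = (record_map x ^^ n) j" by (simp add: funpow_swap1)
    then show ?thesis by blast
  next
    case 3
    then obtain n where "(record_map x ^^ n) j = record_map x i"
      using record_map_noncrossing[OF total] by blast
    then have "(record_map x ^^ 1) i = (record_map x ^^ n) j" by simp
    then show ?thesis by blast
  qed
qed

lemma common_ancestor: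
  assumes "\<And>i. record_map x i \<noteq> i"
  shows "\<exists>m n. (record_map x ^^ m) i = (record_map x ^^ n) j"
  using common_ancestor_le[OF assms, of i j] common_ancestor_le[OF assms, of j i]
  by (metis linear)

text \<open>Levels of the path going backwards from \<open>-1\<close> increase by at most one per step, so
  every level \<open>v\<close> between \<open>height x (-1)\<close> and \<open>0\<close> is visited; its last visit before \<open>0\<close> is a child
  of \<open>0\<close>.\<close>

lemma card_children_ge:
  assumes skip_free: "\<And>n. -1 \<le> x n"
    and unbounded: "\<exists>k < -1. 0 \<le> height x k"
  shows "\<exists>C. finite C \<and> C \<subseteq> {i. i < 0 \<and> record_map x i = 0} \<and> int (card C) = x (-1) + 1"
proof -
  have height_m1: "height x (-1) = - x (-1)"
    using height_add1[of x "-1"] by simp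
  have "\<exists>i<0. height x i = v \<and> record_map x i = 0" if v: "v \<in> {- x (-1)..0}" for v
  proof -
    obtain k where k: "k < -1" "0 \<le> height x k" using unbounded by blast
    let ?I = "{i \<in> {k..-1}. v \<le> height x i}"
    have fin: "finite ?I" by (rule finite_subset[of _ "{k..-1}"]) auto
    have "k \<in> ?I" using k v by auto
    define i where "i = Max ?I"
    have i: "i \<in> ?I" unfolding i_def using fin \<open>k \<in> ?I\<close> by (intro Max_in) auto
    have last: "height x l < v" if "i < l" "l < 0" for l
    proof (rule ccontr)
      assume "\<not> height x l < v"
      then have "l \<in> ?I" using that i by auto
      then show False using Max_ge[OF fin, of l] that(1) i_def by auto
    qed
    \<comment> \<open>Beyond level \<open>v\<close> the walk would have to drop by at least two
      after \<open>i\<close>. At \<open>i = -1\<close> no later time before \<open>0\<close> is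
      left, and the range of \<open>v\<close> gives the bound.\<close>
    have "height x i \<le> v"
    proof (cases "i = -1")
      case True
      then show ?thesis using height_m1 v by auto
    next
      case False
      then have "height x (i + 1) < v" using i by (intro last) auto
      then show ?thesis using height_add1[of x i] skip_free[of i] by linarith
    qed
    then have "height x i = v" using i by auto
    moreover have "record_map x i = 0"
      using i v last \<open>height x i = v\<close> by (intro record_map_eqI) auto
    moreover have "i < 0" using i by simp
    ultimately show ?thesis by blast
  qed
  then obtain f where f: "\<And>v. v \<in> {- x (-1)..0} \<Longrightarrow> f v < 0 \<and> height x (f v) = v \<and> record_map x (f v) = 0"
    by metis
  have "inj_on f {- x (-1)..0}" using f by (metis inj_onI)
  \<comment> \<open>For \<open>x (-1) = -1\<close> the range of levels is empty, in agreement with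
    the count \<open>0\<close>.\<close>
  then have "int (card (f ` {- x (-1)..0})) = x (-1) + 1"
    using skip_free[of "-1"] by (simp add: card_image)
  then show ?thesis using f by (intro exI[of _ "f ` {- x (-1)..0}"]) auto
qed

section \<open>The record graph as a tree\<close>

lemma record_graph_simps [simp]:
  "verts (record_graph x) = UNIV"
  "arcs (record_graph x) = {(i, record_map x i) | i. record_map x i \<noteq> i}"
  "tail (record_graph x) = fst"
  "head (record_graph x) = snd"
  by (simp_all add: record_graph_def)

lemma arcs_ends_record_graph:
  "arcs_ends (record_graph x) = {(i, record_map x i) | i. record_map x i \<noteq> i}"
  by (force simp: arcs_ends_conv)

lemma parcs_mk_symmetric_record_graph:
  "parcs (mk_symmetric (record_graph x)) = {(a, b). a \<noteq> b \<and> (b = record_map x a \<or> a = record_map x b)}"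
proof -
  have "(a, b) \<in> parcs (mk_symmetric (record_graph x)) \<longleftrightarrow> a \<noteq> b \<and> (b = record_map x a \<or> a = record_map x b)"
    for a b
  proof -
    have "(a, b) \<in> parcs (mk_symmetric (record_graph x)) \<longleftrightarrow>
        (\<exists>i. record_map x i \<noteq> i \<and> (a = i \<and> b = record_map x i \<or> a = record_map x i \<and> b = i))"
      by (auto simp: parcs_mk_symmetric)
    then show ?thesis by metis
  qed
  then show ?thesis by (simp add: set_eq_iff split_paired_all)
qed

lemma reachable_funpow_record_map:
  "i \<rightarrow>\<^sup>*\<^bsub>with_proj (mk_symmetric (record_graph x))\<^esub> (record_map x ^^ n) i \<and>
   (record_map x ^^ n) i \<rightarrow>\<^sup>*\<^bsub>with_proj (mk_symmetric (record_graph x))\<^esub> i"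
proof (induction n)
  case 0
  then show ?case by (simp add: reachable_def)
next
  case (Suc n)
  let ?E = "parcs (mk_symmetric (record_graph x))"
  define j where "j = (record_map x ^^ n) i"
  show ?case
  proof (cases "record_map x j = j")
    case True
    then show ?thesis using Suc j_def by simp
  next
    case False
    then have "(j, record_map x j) \<in> ?E" "(record_map x j, j) \<in> ?E"
      by (auto simp: parcs_mk_symmetric_record_graph)
    moreover have "(i, j) \<in> rtrancl_on UNIV ?E" "(j, i) \<in> rtrancl_on UNIV ?E"
      using Suc j_def by (simp_all add: reachable_def)
    ultimately have "(i, record_map x j) \<in> rtrancl_on UNIV ?E" "(record_map x j, i) \<in> rtrancl_on UNIV ?E"
      by (meson UNIV_I rtrancl_on_into_rtrancl_on converse_rtrancl_on_into_rtrancl_on)+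
    then show ?thesis using j_def by (simp add: reachable_def)
  qed
qed

lemma connected_record_graph:
  assumes "\<And>i. record_map x i \<noteq> i"
  shows "Digraph_Component.connected (record_graph x)"
  unfolding Digraph_Component.connected_def
proof (rule strongly_connectedI)
  fix i j
  obtain m n where "(record_map x ^^ m) i = (record_map x ^^ n) j"
    using common_ancestor[OF assms] by blast
  then show "i \<rightarrow>\<^sup>*\<^bsub>with_proj (mk_symmetric (record_graph x))\<^esub> j"
    using reachable_funpow_record_map[where i = i and n = m] reachable_funpow_record_map[where i = j and n = n]
    unfolding reachable_def by (metis rtrancl_on_trans)
qed simp

text \<open>Reduces claims on the component of \<open>0\<close> to the whole record graph;
  well-formedness ensures that restricting to all vertices loses no arc.\<close>

lemma weak_component_of_connected:
  assumes "Digraph_Component.connected G" "u \<in> verts G" "wf_digraph G"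
  shows "weak_component G u = G"
proof -
  have "{v. u \<rightarrow>\<^sup>*\<^bsub>with_proj (mk_symmetric G)\<^esub> v} = verts G"
  proof
    show "{v. u \<rightarrow>\<^sup>*\<^bsub>with_proj (mk_symmetric G)\<^esub> v} \<subseteq> verts G"
      by (auto elim: reachable_in_vertsE)
    show "verts G \<subseteq> {v. u \<rightarrow>\<^sup>*\<^bsub>with_proj (mk_symmetric G)\<^esub> v}"
      using assms(1,2) by (simp add: Digraph_Component.connected_def strongly_connected_def subset_iff)
  qed
  moreover have "{e \<in> arcs G. tail G e \<in> verts G \<and> head G e \<in> verts G} = arcs G"
    using wf_digraph.tail_in_verts[OF assms(3)] wf_digraph.head_in_verts[OF assms(3)] by blast
  ultimately show ?thesis by (simp add: weak_component_def induce_subgraph_def)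
qed

lemma wf_digraph_record_graph: "wf_digraph (record_graph x)"
  by unfold_locales auto

text \<open>Both maps default to the vertex itself, so they agree also where there is no
  record.\<close>

lemma parent_record_graph: "parent (record_graph x) = record_map x"
  by (auto simp: parent_def arcs_ends_record_graph fun_eq_iff)

text \<open>Both neighbours on a cycle of its smallest vertex \<open>w\<close> are the record of \<open>w\<close>, so the cycle
  goes back and forth along one edge.\<close>

lemma length_cycle_record_graph:
  assumes "pre_digraph.cycle (with_proj (mk_symmetric (record_graph x))) p"
  shows "length p = 2"
proof -
  interpret pair_wf_digraph "mk_symmetric (record_graph x)"
    by (rule wf_digraph.wellformed_mk_symmetric[OF wf_digraph_record_graph])
  obtain u where p: "awalk u p u" "distinct (tl (awalk_verts u p))" "p \<noteq> []"
    using assms unfolding cycle_def by blast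
  have arcs: "fst e \<noteq> snd e \<and> (snd e = record_map x (fst e) \<or> fst e = record_map x (snd e))"
    if "e \<in> set p" for e
  proof -
    have "(fst e, snd e) \<in> parcs (mk_symmetric (record_graph x))"
      using that p(1) by (auto simp: awalk_def)
    then show ?thesis unfolding parcs_mk_symmetric_record_graph mem_Collect_eq prod.case .
  qed
  have cas: "pcas u p u" using p(1) by (simp add: awalk_def)
  have verts_eq: "pawalk_verts u p = map fst p @ [snd (last p)]"
      "pawalk_verts u p = fst (hd p) # map snd p"
    using awalk_verts_conv[of u p] awalk_verts_conv'[OF cas] p(3) by simp_all
  define n where "n = length p"
  have n: "n > 0" using p(3) n_def by simp
  have ends: "fst (p ! 0) = snd (p ! (n - 1))"
    using p(3) n_def cas awhd_if_cas[OF cas] awlast_if_cas[OF cas] verts_eq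
    by (metis hd_conv_nth last_conv_nth last_snoc list.sel(1))
  have step: "fst (p ! Suc i) = snd (p ! i)" if "Suc i < n" for i
  proof -
    have "(map fst p @ [snd (last p)]) ! Suc i = (fst (hd p) # map snd p) ! Suc i"
      using verts_eq by simp
    then show ?thesis using that n_def by (simp add: nth_append)
  qed
  \<comment> \<open>Cyclic successor and predecessor of an arc index, since the smallest vertex may
    sit anywhere on the cycle.\<close>
  define nxt where "nxt i = (if Suc i < n then Suc i else 0)" for i
  define prv where "prv i = (if i = 0 then n - 1 else i - 1)" for i
  have nxt_less: "nxt i < n" and prv_less: "prv i < n" and prv_nxt: "prv (nxt i) = i"
    if "i < n" for i
    using that by (auto simp: nxt_def prv_def)
  have fst_eq: "fst (p ! i) = snd (p ! prv i)" if "i < n" for i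
    using that ends step[of "i - 1"] by (cases i) (simp_all add: prv_def)
  have fst_nxt: "fst (p ! nxt i) = snd (p ! i)" if "i < n" for i
    using fst_eq[OF nxt_less[OF that]] prv_nxt[OF that] by simp
  have "distinct (map snd p)" using p(2) verts_eq(2) by simp
  then have inj_snd: "i = j" if "snd (p ! i) = snd (p ! j)" "i < n" "j < n" for i j
    using that n_def by (simp add: distinct_conv_nth) metis
  have inj_fst: "i = j" if "fst (p ! i) = fst (p ! j)" "i < n" "j < n" for i j
  proof -
    have "prv i = prv j"
      using inj_snd[of "prv i" "prv j"] that fst_eq prv_less by simp
    then show ?thesis using that(2,3) by (auto simp: prv_def split: if_splits)
  qed
  define w where "w = Min (fst ` set p)"
  have w_le: "w \<le> fst (p ! i)" if "i < n" for i
    using that n_def unfolding w_def by (intro Min_le) auto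
  have "w \<in> fst ` set p" unfolding w_def using p(3) by (intro Min_in) auto
  then obtain i where i: "i < n" "fst (p ! i) = w"
    by (metis imageE in_set_conv_nth n_def)
  define j where "j = prv i"
  have j: "j < n" using prv_less[OF i(1)] j_def by simp
  have j_snd: "snd (p ! j) = w" using fst_eq[OF i(1)] i(2) j_def by simp
  have "p ! i \<in> set p" "p ! j \<in> set p" using i(1) j n_def by simp_all
  then have edges: "w \<noteq> snd (p ! i) \<and> (snd (p ! i) = record_map x w \<or> w = record_map x (snd (p ! i)))"
      "w \<noteq> fst (p ! j) \<and> (w = record_map x (fst (p ! j)) \<or> fst (p ! j) = record_map x w)"
    using arcs[of "p ! i"] arcs[of "p ! j"] i(2) j_snd by simp_all
  \<comment> \<open>Records move to the right, so of the two ends of an edge the smaller one has the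
    larger one as its record.\<close>
  have "w < fst (p ! j)" using w_le[OF j] edges(2) by simp
  then have fst_j: "fst (p ! j) = record_map x w"
    using edges(2) record_map_gt[of x "fst (p ! j)"] by force
  have "w < snd (p ! i)" using w_le[OF nxt_less[OF i(1)]] fst_nxt[OF i(1)] edges(1) by simp
  then have snd_i: "snd (p ! i) = record_map x w"
    using edges(1) record_map_gt[of x "snd (p ! i)"] by force
  have "j = nxt i"
    using fst_j snd_i fst_nxt[OF i(1)] nxt_less[OF i(1)] j by (intro inj_fst) simp_all
  \<comment> \<open>Successor and predecessor of \<open>i\<close> coincide only for
    \<open>n = 1\<close> or \<open>n = 2\<close>; the absence of loops excludes
    \<open>n = 1\<close>.\<close>
  moreover have "i \<noteq> j" using i(2) edges(2) by auto
  ultimately have "n = 2"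
    using j_def i(1) by (auto simp: nxt_def prv_def split: if_splits)
  then show ?thesis by (simp add: n_def)
qed

text \<open>Edges pointing to the right make the arcs asymmetric, and children are among the
  finitely many descendants, which gives local finiteness.\<close>

lemma family_tree_record_graph:
  assumes total: "\<And>i. record_map x i \<noteq> i"
    and descendants: "\<And>j. finite {i. \<exists>n. (record_map x ^^ n) i = j}"
  shows "family_tree (record_graph x)"
proof -
  have gt: "i < record_map x i" for i using total record_map_gt by blast
  have "nomulti_digraph (record_graph x)"
    by (intro nomulti_digraph.intro wf_digraph_record_graph nomulti_digraph_axioms.intro)
       (auto simp: arc_to_ends_def)
  moreover have "asym (arcs_ends (record_graph x))"
  proof (rule asymI)
    fix a b assume "(a, b) \<in> arcs_ends (record_graph x)"
    then have "b = record_map x a" by (auto simp: arcs_ends_record_graph)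
    then show "(b, a) \<notin> arcs_ends (record_graph x)"
      using gt[of a] gt[of b] by (auto simp: arcs_ends_record_graph)
  qed
  ultimately have "directed_tree (record_graph x)"
    using connected_record_graph[OF total] length_cycle_record_graph by (simp add: directed_tree_def)
  moreover have out: "out_arcs (record_graph x) v = {(v, record_map x v)}" for v
    using total by (auto simp: out_arcs_def)
  moreover have "finite (in_arcs (record_graph x) v)" for v
  proof (rule finite_subset)
    show "in_arcs (record_graph x) v \<subseteq> (\<lambda>i. (i, v)) ` {i. \<exists>n. (record_map x ^^ n) i = v}"
    proof
      fix e assume "e \<in> in_arcs (record_graph x) v"
      then obtain i where "e = (i, v)" "(record_map x ^^ 1) i = v" by (auto simp: in_arcs_def)
      then show "e \<in> (\<lambda>i. (i, v)) ` {i. \<exists>n. (record_map x ^^ n) i = v}" by blast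
    qed
  qed (use descendants in blast)
  ultimately show ?thesis
    by (simp add: family_tree_def locally_finite_digraph_def out_degree_def)
qed

section \<open>Foils\<close>

text \<open>Generations are compared through a common ancestor, without a level function; earlier
  means farther down among the descendants.\<close>

definition earlier_generation :: "('a \<Rightarrow> 'a) \<Rightarrow> 'a \<Rightarrow> 'a \<Rightarrow> bool" where
  "earlier_generation R v w \<longleftrightarrow> (\<exists>m n. n < m \<and> (R ^^ m) v = (R ^^ n) w)"

definition first_generation :: "('a \<Rightarrow> 'a) \<Rightarrow> 'a set" where
  "first_generation R = {v. \<forall>w. \<not> earlier_generation R w v}"

lemma funpow_compose_eq:
  fixes R :: "'a \<Rightarrow> 'a"
  assumes "(R ^^ m) u = (R ^^ n) v" "(R ^^ k) v = (R ^^ l) w"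
  shows "(R ^^ (k + m)) u = (R ^^ (n + l)) w"
proof -
  have "(R ^^ (k + m)) u = (R ^^ k) ((R ^^ n) v)" using assms(1) by (simp add: funpow_add)
  also have "\<dots> = (R ^^ (k + n)) v" by (simp add: funpow_add)
  also have "\<dots> = (R ^^ (n + k)) v" by (simp only: add.commute)
  also have "\<dots> = (R ^^ (n + l)) w" using assms(2) by (simp add: funpow_add)
  finally show ?thesis .
qed

lemma earlier_generation_trans:
  assumes "earlier_generation R u v" "earlier_generation R v w"
  shows "earlier_generation R u w"
proof -
  obtain m n k l where *: "n < m" "(R ^^ m) u = (R ^^ n) v" "l < k" "(R ^^ k) v = (R ^^ l) w"
    using assms by (auto simp: earlier_generation_def)
  then have "n + l < k + m" "(R ^^ (k + m)) u = (R ^^ (n + l)) w"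
    using funpow_compose_eq[OF *(2,4)] by simp_all
  then show ?thesis unfolding earlier_generation_def by blast
qed

lemma funpow_strict_increasing:
  fixes R :: "'a::order \<Rightarrow> 'a"
  assumes "\<And>i. i < R i" "m < n"
  shows "(R ^^ m) i < (R ^^ n) i"
  using lift_Suc_mono_less[of "\<lambda>n. (R ^^ n) i" m n] assms by simp

text \<open>If a foil is finite, then so is the set of its descendants, hence these die out: the
  generations of the tree are bounded from below, and the first one is finite.\<close>

lemma finite_first_generation:
  fixes R :: "int \<Rightarrow> int"
  assumes increasing: "\<And>i. i < R i"
    and connected: "\<And>i j. \<exists>m n. (R ^^ m) i = (R ^^ n) j"
    and descendants: "\<And>j. finite {i. \<exists>n. (R ^^ n) i = j}"
    and foil: "finite {v. \<exists>n. (R ^^ n) v = (R ^^ n) u}"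
  shows "finite (first_generation R)" "first_generation R \<noteq> {}"
proof -
  \<comment> \<open>The generation of \<open>u\<close> and all earlier ones, that is, the foil of
    \<open>u\<close> with all its descendants.\<close>
  define L where "L = {v. \<exists>m n. n \<le> m \<and> (R ^^ m) v = (R ^^ n) u}"
  have "L \<subseteq> (\<Union>w\<in>{v. \<exists>n. (R ^^ n) v = (R ^^ n) u}. {i. \<exists>n. (R ^^ n) i = w})"
  proof
    fix v assume "v \<in> L"
    then obtain m n where mn: "n \<le> m" "(R ^^ m) v = (R ^^ n) u" by (auto simp: L_def)
    then have "(R ^^ n) ((R ^^ (m - n)) v) = (R ^^ n) u"
      using funpow_add[of n "m - n" R] by simp
    then have "(R ^^ (m - n)) v \<in> {v. \<exists>n. (R ^^ n) v = (R ^^ n) u}" by blast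
    then show "v \<in> (\<Union>w\<in>{v. \<exists>n. (R ^^ n) v = (R ^^ n) u}. {i. \<exists>n. (R ^^ n) i = w})"
      by (rule UN_I) blast
  qed
  moreover have "finite (\<Union>w\<in>{v. \<exists>n. (R ^^ n) v = (R ^^ n) u}. {i. \<exists>n. (R ^^ n) i = w})"
    using foil descendants by (rule finite_UN_I)
  ultimately have fin: "finite L" by (rule finite_subset)
  have "first_generation R \<subseteq> L"
  proof
    fix v assume v: "v \<in> first_generation R"
    obtain m n where mn: "(R ^^ m) v = (R ^^ n) u" using connected by blast
    have "\<not> m < n"
    proof
      assume "m < n"
      then have "earlier_generation R u v"
        using mn[symmetric] unfolding earlier_generation_def by blast
      then show False using v by (simp add: first_generation_def)
    qed
    then have "n \<le> m" by simp
    then show "v \<in> L" using mn by (auto simp: L_def)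
  qed
  then show "finite (first_generation R)" using fin by (rule finite_subset)
  have irrefl: "\<not> earlier_generation R v v" for v
  proof
    assume "earlier_generation R v v"
    then obtain m n where "n < m" "(R ^^ m) v = (R ^^ n) v" by (auto simp: earlier_generation_def)
    then show False using funpow_strict_increasing[of R n m v] increasing by simp
  qed
  have "u \<in> L" by (auto simp: L_def)
  have "asymp_on L (earlier_generation R)"
    by (rule asymp_onI) (metis irrefl earlier_generation_trans)
  moreover have "transp_on L (earlier_generation R)"
    by (rule transp_onI) (rule earlier_generation_trans)
  ultimately obtain v where v: "v \<in> L" "\<And>w. w \<in> L \<Longrightarrow> w \<noteq> v \<Longrightarrow> \<not> earlier_generation R w v"
    using Finite_Set.bex_min_element[OF fin, of "earlier_generation R"] \<open>u \<in> L\<close> by blast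
  \<comment> \<open>\<open>L\<close> is closed under passing to an earlier generation, so minimality
    in \<open>L\<close> is minimality among all vertices.\<close>
  have "\<not> earlier_generation R w v" for w
  proof
    assume w: "earlier_generation R w v"
    then obtain k l where kl: "l < k" "(R ^^ k) w = (R ^^ l) v" by (auto simp: earlier_generation_def)
    obtain m n where mn: "n \<le> m" "(R ^^ m) v = (R ^^ n) u" using v(1) by (auto simp: L_def)
    have "(R ^^ (m + k)) w = (R ^^ (l + n)) u" using funpow_compose_eq[OF kl(2) mn(2)] .
    moreover have "l + n \<le> m + k" using kl mn by simp
    ultimately have "w \<in> L" unfolding L_def by blast
    then show False using v(2) w irrefl by blast
  qed
  then show "first_generation R \<noteq> {}" by (auto simp: first_generation_def)
qed

text \<open>A finite foil would give a finite nonempty first generation; its least element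
  contradicts \<open>no_first\<close>.\<close>

lemma class_I_I_record_graph:
  assumes total: "\<And>i. record_map x i \<noteq> i"
    and descendants: "\<And>j. finite {i. \<exists>n. (record_map x ^^ n) i = j}"
    and no_first: "\<And>k. k \<in> first_generation (record_map x) \<Longrightarrow> \<exists>j<k. j \<in> first_generation (record_map x)"
  shows "class_I_I (record_graph x)"
proof -
  have "infinite (foil (record_graph x) u)" for u
  proof
    assume "finite (foil (record_graph x) u)"
    then have "finite {v. \<exists>n. (record_map x ^^ n) v = (record_map x ^^ n) u}"
      by (simp add: foil_def parent_record_graph)
    note first = finite_first_generation[OF record_map_gt[OF total] common_ancestor[OF total] descendants this]
    obtain j where "j < Min (first_generation (record_map x))" "j \<in> first_generation (record_map x)"
      using no_first[OF Min_in[OF first]] by blast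
    then show False using Min_le[OF first(1)] by fastforce
  qed
  then show ?thesis by (simp add: class_I_I_def infinite_UNIV_int)
qed

section \<open>Independent increments\<close>

lemma sum_shift_int:
  fixes x :: "int \<Rightarrow> int"
  shows "(\<Sum>l\<in>{i..<j}. x (l + k)) = (\<Sum>l\<in>{i + k..<j + k}. x l)"
  by (rule sum.reindex_bij_witness[of _ "\<lambda>l. l - k" "\<lambda>l. l + k"]) auto

text \<open>Shift equivariance: records depend only on height differences, which do not change when
  the height is pinned at another time.\<close>

lemma record_map_shift:
  "record_map (\<lambda>i. x (i + k)) i = record_map x (i + k) - k"
proof -
  have diff: "height (\<lambda>i. x (i + k)) j - height (\<lambda>i. x (i + k)) i = height x (j + k) - height x (i + k)"
    if "i \<le> j" for j
    using that sum_shift_int[of x k i j]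
      sum_eq_height_diff[of i j "\<lambda>i. x (i + k)"] sum_eq_height_diff[of "i + k" "j + k" x]
    by simp
  show ?thesis
  proof (cases x "i + k" rule: record_map_cases)
    case none
    have "record_map (\<lambda>i. x (i + k)) i = i"
    proof (rule record_map_eq_self)
      fix j assume "i < j"
      then show "height (\<lambda>i. x (i + k)) j < height (\<lambda>i. x (i + k)) i"
        using diff[of j] none(2)[of "j + k"] by simp
    qed
    then show ?thesis using none(1) by simp
  next
    case exists_record
    show ?thesis
    proof (rule record_map_eqI)
      show "i < record_map x (i + k) - k" using exists_record(1) by simp
      then show "height (\<lambda>i. x (i + k)) i \<le> height (\<lambda>i. x (i + k)) (record_map x (i + k) - k)"
        using diff[of "record_map x (i + k) - k"] exists_record(2) by simp
      fix j assume "i < j" "j < record_map x (i + k) - k"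
      then show "height (\<lambda>i. x (i + k)) j < height (\<lambda>i. x (i + k)) i"
        using diff[of j] exists_record(3)[of "j + k"] by simp
    qed
  qed
qed

lemma funpow_record_map_shift:
  "(record_map (\<lambda>i. x (i + k)) ^^ n) i = (record_map x ^^ n) (i + k) - k"
  by (induction n) (simp_all add: record_map_shift)

text \<open>Reading increments backwards from \<open>j - 1\<close> turns the past of
  \<open>j\<close> into a one-sided walk.\<close>

lemma sum_lessThan_reflected:
  "(\<Sum>i<n. x (j - 1 - int i)) = height x j - height x (j - int n)"
proof (induction n)
  case (Suc n)
  show ?case using Suc height_add1[of x "j - 1 - int n"] by (simp add: algebra_simps)
qed simp

lemma measurable_count_space_compose2:
  fixes f g :: "'a \<Rightarrow> 'b::countable"
  assumes f: "f \<in> measurable M (count_space UNIV)" and g: "g \<in> measurable M (count_space UNIV)"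
  shows "(\<lambda>x. h (f x) (g x)) \<in> measurable M (count_space UNIV)"
proof (rule measurable_compose_countable[OF _ f])
  show "(\<lambda>x. h i (g x)) \<in> measurable M (count_space UNIV)" for i
    by (rule measurable_compose[OF g]) simp
qed

lemma measurable_count_space_sum:
  fixes f :: "'i \<Rightarrow> 'a \<Rightarrow> int"
  assumes "\<And>i. f i \<in> measurable M (count_space UNIV)"
  shows "(\<lambda>x. \<Sum>i\<in>I. f i x) \<in> measurable M (count_space UNIV)"
  by (induction I rule: infinite_finite_induct)
     (simp_all add: measurable_count_space_compose2[OF assms, of _ "(+)"])

section \<open>The product law of the increments and the walk killed at the nonpositive
  integers\<close>

locale skip_free_law = prob_space \<mu> for \<mu> :: "int measure" +
  assumes sets_law [measurable_cong]: "sets \<mu> = sets (count_space UNIV)"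
    and AE_ge: "AE y in \<mu>. -1 \<le> y"
    and down: "0 < measure \<mu> {-1}"
    and integrable_law: "integrable \<mu> real_of_int"
    and mean_law: "integral\<^sup>L \<mu> real_of_int = 0"
begin

abbreviation iid :: "('i \<Rightarrow> int) measure" where
  "iid \<equiv> PiM UNIV (\<lambda>_. \<mu>)"

lemma space_law [simp]: "space \<mu> = UNIV"
  using sets_eq_imp_space_eq[OF sets_law] by simp

lemma space_iid [simp]: "space iid = UNIV"
  by (simp add: space_PiM)

lemma measurable_law: "f \<in> measurable \<mu> N \<longleftrightarrow> f \<in> UNIV \<rightarrow> space N"
  by (simp add: measurable_cong_sets[OF sets_law refl])

lemma measurable_iid_component [measurable]: "(\<lambda>x. x i) \<in> measurable iid (count_space UNIV)"
  using measurable_component_singleton[of i UNIV "\<lambda>_. \<mu>"] measurable_cong_sets[OF refl sets_law]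
  by blast

lemma measurable_reindex: "(\<lambda>x i. x (f i)) \<in> measurable iid iid"
  by (rule measurable_PiM_single') (auto simp: space_PiM intro: measurable_component_singleton)

text \<open>Covers both the shifts of the integers and the embedding of the naturals that reads the
  past of a vertex backwards.\<close>

lemma distr_iid_reindex:
  assumes "inj f"
  shows "distr iid iid (\<lambda>x i. x (f i)) = iid"
  using distr_PiM_reindex[of UNIV "\<lambda>_. \<mu>" f UNIV] assms prob_space_axioms by (simp add: restrict_def)

lemma prob_space_iid: "prob_space iid"
  by (rule prob_space_PiM) (rule prob_space_axioms)

lemma AE_iid_reindex:
  assumes "inj f" "AE x in iid. Q x"
  shows "AE x in iid. Q (\<lambda>i. x (f i))"
  using assms(2) by (subst (asm) distr_iid_reindex[OF assms(1), symmetric]) (rule AE_distrD[OF measurable_reindex])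

lemma AE_iid_ge: "AE x in iid. \<forall>n::int. -1 \<le> x n"
  unfolding AE_all_countable
  by (intro allI AE_PiM_component[of UNIV "\<lambda>_. \<mu>"] prob_space_axioms UNIV_I AE_ge)

text \<open>The probability that the walk started at \<open>a\<close> stays positive forever. Time
  \<open>n = 0\<close> is included, which makes it vanish at nonpositive \<open>a\<close>.\<close>

definition survival :: "int \<Rightarrow> real" where
  "survival a = measure iid {\<omega>::nat \<Rightarrow> int. \<forall>n. - a < (\<Sum>i<n. \<omega> i)}"

lemma sets_survival: "{\<omega>::nat \<Rightarrow> int. \<forall>n. - a < (\<Sum>i<n. \<omega> i)} \<in> sets iid"
proof -
  have [measurable]: "(\<lambda>\<omega>. \<Sum>i<n. \<omega> i) \<in> measurable iid (count_space UNIV)" for n :: nat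
    by (rule measurable_count_space_sum) measurable
  have "{\<omega> \<in> space iid. \<forall>n::nat. - a < (\<Sum>i<n. \<omega> i)} \<in> sets iid"
    by measurable
  then show ?thesis by simp
qed

lemma survival_bounds: "0 \<le> survival a" "survival a \<le> 1"
proof -
  interpret iid: prob_space "iid :: (nat \<Rightarrow> int) measure" by (rule prob_space_iid)
  show "0 \<le> survival a" "survival a \<le> 1" by (simp_all add: survival_def)
qed

lemma survival_nonpos: "a \<le> 0 \<Longrightarrow> survival a = 0"
proof -
  assume "a \<le> 0"
  then have "{\<omega>::nat \<Rightarrow> int. \<forall>n. - a < (\<Sum>i<n. \<omega> i)} = ({} :: (nat \<Rightarrow> int) set)"
    by (auto intro!: exI[of _ 0])
  then show ?thesis by (simp only: survival_def measure_empty)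
qed

lemma integrable_survival: "integrable \<mu> (\<lambda>y. survival (f y))"
  by (rule integrable_const_bound[of _ 1])
     (auto simp: survival_bounds measurable_law)

text \<open>First step analysis: dropping the first increment \<open>y\<close> leaves a sequence
  with the same law, now started at \<open>a + y\<close>; \<open>0 < a\<close> settles time
  \<open>0\<close>.\<close>

lemma survival_step:
  assumes "0 < a"
  shows "survival a = (\<integral>y. survival (a + y) \<partial>\<mu>)"
proof -
  interpret seq: sequence_space \<mu> by unfold_locales
  let ?G = "\<lambda>a. {\<omega>::nat \<Rightarrow> int. \<forall>n. - a < (\<Sum>i<n. \<omega> i)}"
  have G: "case_nat y \<omega> \<in> ?G a \<longleftrightarrow> \<omega> \<in> ?G (a + y)" for y \<omega>
  proof
    assume *: "case_nat y \<omega> \<in> ?G a"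
    have "- (a + y) < (\<Sum>i<n. \<omega> i)" for n
    proof -
      have "- a < (\<Sum>i<Suc n. case_nat y \<omega> i)" using * by blast
      then show ?thesis by (simp only: sum.lessThan_Suc_shift) simp
    qed
    then show "\<omega> \<in> ?G (a + y)" by simp
  next
    assume *: "\<omega> \<in> ?G (a + y)"
    have "- a < (\<Sum>i<n. case_nat y \<omega> i)" for n
    proof (cases n)
      case 0
      then show ?thesis using assms by simp
    next
      case (Suc k)
      have "- (a + y) < (\<Sum>i<k. \<omega> i)" using * by blast
      then show ?thesis unfolding Suc by (simp only: sum.lessThan_Suc_shift) simp
    qed
    then show "case_nat y \<omega> \<in> ?G a" by simp
  qed
  have meas: "(\<lambda>(s, \<omega>). case_nat s \<omega>) \<in> measurable (\<mu> \<Otimes>\<^sub>M iid) iid"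
    by measurable
  have "emeasure iid (?G a) = emeasure (distr (\<mu> \<Otimes>\<^sub>M iid) iid (\<lambda>(s, \<omega>). case_nat s \<omega>)) (?G a)"
    by (simp only: seq.PiM_iter)
  also have "\<dots> = emeasure (\<mu> \<Otimes>\<^sub>M iid) ((\<lambda>(s, \<omega>). case_nat s \<omega>) -` ?G a \<inter> space (\<mu> \<Otimes>\<^sub>M iid))"
    by (rule emeasure_distr[OF meas sets_survival])
  also have "\<dots> = (\<integral>\<^sup>+y. emeasure iid (Pair y -` ((\<lambda>(s, \<omega>). case_nat s \<omega>) -` ?G a \<inter> space (\<mu> \<Otimes>\<^sub>M iid))) \<partial>\<mu>)"
    by (rule seq.P.emeasure_pair_measure_alt[OF measurable_sets[OF meas sets_survival]])
  also have "\<dots> = (\<integral>\<^sup>+y. emeasure iid (?G (a + y)) \<partial>\<mu>)"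
    by (intro nn_integral_cong arg_cong[of _ _ "emeasure iid"])
       (simp only: set_eq_iff vimage_eq Int_iff prod.case G space_pair_measure mem_Sigma_iff
         space_law space_iid UNIV_I simp_thms)
  also have "\<dots> = (\<integral>\<^sup>+y. ennreal (survival (a + y)) \<partial>\<mu>)"
    by (simp add: survival_def seq.P.emeasure_eq_measure)
  also have "\<dots> = ennreal (\<integral>y. survival (a + y) \<partial>\<mu>)"
    by (rule nn_integral_eq_integral[OF integrable_survival]) (simp add: survival_bounds)
  finally show ?thesis
    by (simp add: survival_def[of a, symmetric] seq.P.emeasure_eq_measure survival_bounds
        integral_nonneg_AE)
qed

text \<open>The identity and \<^const>\<open>survival\<close> are both harmonic for the walk killed below \<open>1\<close>. As
  \<^const>\<open>survival\<close> is bounded, \<open>survival a / a\<close> would attain a positive maximum, and at the largest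
  maximiser this contradicts harmonicity, because upward steps have positive probability.\<close>

lemma survival_eq_0: "survival a = 0"
proof (rule ccontr)
  assume "survival a \<noteq> 0"
  then have a: "0 < a" "0 < survival a"
    using survival_nonpos[of a] survival_bounds(1)[of a] by force+
  define q where "q b = survival b / real_of_int b" for b
  have "0 < q a" using a by (simp add: q_def)
  \<comment> \<open>As \<open>survival\<close> is at most \<open>1\<close>, \<open>q b\<close> is at
    most \<open>1 / b\<close>, and only finitely many \<open>b\<close> compete for the
    maximum.\<close>
  have bound: "b \<le> \<lceil>1 / q a\<rceil>" if "0 < b" "q a \<le> q b" for b
  proof -
    have "real_of_int b * q a \<le> real_of_int b * q b" using that by simp
    also have "\<dots> \<le> 1" using that survival_bounds[of b] by (simp add: q_def)
    finally have "real_of_int b \<le> 1 / q a" using \<open>0 < q a\<close> by (simp add: field_simps)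
    then show ?thesis by linarith
  qed
  define B where "B = {b. 0 < b \<and> q a \<le> q b}"
  have "finite B"
    using bound by (intro finite_subset[of B "{0..\<lceil>1 / q a\<rceil>}"]) (auto simp: B_def)
  moreover have "a \<in> B" using a by (simp add: B_def)
  ultimately have m_in: "Max (q ` B) \<in> q ` B" by (intro Max_in) auto
  define m where "m = Max (q ` B)"
  have q_le: "q b \<le> m" if "0 < b" for b
  proof (cases "b \<in> B")
    case True
    then show ?thesis using \<open>finite B\<close> by (simp add: m_def)
  next
    case False
    then have "q b \<le> q a" using that by (simp add: B_def)
    also have "\<dots> \<le> m" using \<open>finite B\<close> \<open>a \<in> B\<close> by (simp add: m_def)
    finally show ?thesis .
  qed
  have "0 < m" using q_le[of a] a \<open>0 < q a\<close> by simp
  define C where "C = {b \<in> B. q b = m}"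
  have "finite C" "C \<noteq> {}" using \<open>finite B\<close> m_in by (auto simp: C_def m_def)
  define c where "c = Max C"
  have "c \<in> C" unfolding c_def using \<open>finite C\<close> \<open>C \<noteq> {}\<close> by (rule Max_in)
  then have c: "0 < c" "q c = m" "c \<in> B" by (auto simp: C_def B_def)
  have q_less: "q b < m" if "c < b" for b
  proof (rule ccontr)
    assume "\<not> q b < m"
    then have "q b = m" using q_le[of b] that c by simp
    then have "b \<in> C" using c that by (auto simp: C_def B_def)
    then show False using Max_ge[OF \<open>finite C\<close>] that c_def by force
  qed
  \<comment> \<open>The gap between the line of slope \<open>m\<close> and \<open>survival\<close>
    one step after \<open>c\<close>. It is nonnegative because skip-freeness keeps
    \<open>c + y\<close> at least \<open>0\<close>, and its mean is zero because
    \<open>q c = m\<close>.\<close>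
  let ?f = "\<lambda>y. m * (real_of_int c + real_of_int y) - survival (c + y)"
  have survival_le: "survival b \<le> m * real_of_int b" if "0 \<le> b" for b
  proof (cases "b = 0")
    case False
    then show ?thesis using q_le[of b] that by (simp add: q_def field_simps)
  qed (simp add: survival_nonpos)
  have nonneg: "AE y in \<mu>. 0 \<le> ?f y"
    using AE_ge
  proof eventually_elim
    case (elim y)
    then show ?case using survival_le[of "c + y"] c(1) by simp
  qed
  have integrable: "integrable \<mu> ?f"
    using integrable_law integrable_survival by simp
  have "integral\<^sup>L \<mu> ?f = m * real_of_int c - survival c"
    using integrable_law integrable_survival
    by (simp add: mean_law survival_step[OF c(1)] prob_space[unfolded space_law] algebra_simps)
  also have "\<dots> = 0" using c by (simp add: q_def field_simps)
  finally have "AE y in \<mu>. ?f y = 0"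
    using integral_nonneg_eq_0_iff_AE[OF integrable nonneg] by simp
  then have "AE y in \<mu>. y \<le> 0"
  proof eventually_elim
    case (elim y)
    show ?case
    proof (rule ccontr)
      assume "\<not> y \<le> 0"
      then have "q (c + y) < m" "0 < real_of_int c + real_of_int y" using q_less[of "c + y"] c(1) by simp_all
      then have "survival (c + y) < m * (real_of_int c + real_of_int y)"
        by (simp add: q_def divide_less_eq)
      then show False using elim by simp
    qed
  qed
  \<comment> \<open>A nonpositive variable of mean zero vanishes almost surely, against the mass at
    \<open>-1\<close>.\<close>
  then have "AE y in \<mu>. 0 \<le> - real_of_int y" by eventually_elim simp
  then have "AE y in \<mu>. - real_of_int y = 0"
    using integral_nonneg_eq_0_iff_AE[of \<mu> "\<lambda>y. - real_of_int y"] integrable_law mean_law by simp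
  then have "AE y in \<mu>. y \<notin> {-1}" by eventually_elim simp
  then have "measure \<mu> {-1} = 0"
    using AE_iff_measurable[of "{-1}" \<mu> "\<lambda>y. y \<notin> {-1}"] sets_law by (auto simp: measure_def)
  then show False using down by simp
qed

text \<open>By \<open>survival 1 = 0\<close>, the sums of the increments read backwards from
  \<open>j\<close> become negative almost surely; a negative sum means a greater height
  earlier.\<close>

lemma AE_backward_descent: "AE x in iid. \<forall>j. \<exists>k<j. height x j < height x k"
  unfolding AE_all_countable
proof
  fix j :: int
  interpret iid: prob_space "iid :: (nat \<Rightarrow> int) measure" by (rule prob_space_iid)
  have "AE \<omega> in iid. \<exists>n::nat. (\<Sum>i<n. \<omega> i) < 0"
  proof (rule AE_I')
    have "emeasure iid {\<omega>::nat \<Rightarrow> int. \<forall>n. - 1 < (\<Sum>i<n. \<omega> i)} = 0"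
      using survival_eq_0[of 1] by (simp add: survival_def iid.emeasure_eq_measure)
    then show "{\<omega>::nat \<Rightarrow> int. \<forall>n. - 1 < (\<Sum>i<n. \<omega> i)} \<in> null_sets iid"
      using sets_survival[of 1] by (intro null_setsI)
    show "{\<omega> \<in> space iid. \<not> (\<exists>n::nat. (\<Sum>i<n. \<omega> i) < 0)} \<subseteq> {\<omega>. \<forall>n::nat. - 1 < (\<Sum>i<n. \<omega> i)}"
    proof clarify
      fix \<omega> :: "nat \<Rightarrow> int" and n :: nat
      assume "\<not> (\<exists>n::nat. (\<Sum>i<n. \<omega> i) < 0)"
      then have "\<not> (\<Sum>i<n. \<omega> i) < 0" by blast
      then show "- 1 < (\<Sum>i<n. \<omega> i)" by simp
    qed
  qed
  then have "AE x in iid. \<exists>n. (\<Sum>i<n. x (j - 1 - int i)) < 0"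
    by (intro AE_iid_reindex[where f = "\<lambda>n. j - 1 - int n" and Q = "\<lambda>\<omega>. \<exists>n. (\<Sum>i<n. \<omega> i) < 0"])
      (simp_all add: inj_def)
  then show "AE x in iid. \<exists>k<j. height x j < height x k"
  proof eventually_elim
    case (elim x)
    then obtain n where "height x j < height x (j - int n)"
      unfolding sum_lessThan_reflected by auto
    moreover from this have "n \<noteq> 0" by (intro notI) simp
    ultimately show ?case by (intro exI[of _ "j - int n"]) simp
  qed
qed

section \<open>Measurability of heights and records\<close>

lemma measurable_height [measurable]: "(\<lambda>x. height x n) \<in> measurable iid (count_space UNIV)"
proof (cases "0 \<le> n")
  case True
  then show ?thesis
    by (simp add: height_def measurable_count_space_sum)
next
  case False
  have "(\<lambda>x. \<Sum>l\<in>{n..<0}. x l) \<in> measurable iid (count_space UNIV)"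
    by (rule measurable_count_space_sum) measurable
  from measurable_compose[OF this, of uminus "count_space UNIV"]
  show ?thesis using False by (simp add: height_def)
qed

lemma measurable_record_map [measurable]:
  "(\<lambda>x. record_map x i) \<in> measurable iid (count_space UNIV)"
proof -
  have "{x \<in> space iid. record_map x i = j} \<in> sets iid" for j
    unfolding record_map_eq_iff by measurable
  then show ?thesis
    by (subst measurable_count_space_eq2_countable) (auto simp: vimage_def Int_def conj_commute)
qed

lemma measurable_funpow_record_map [measurable]:
  "(\<lambda>x. (record_map x ^^ n) i) \<in> measurable iid (count_space UNIV)"
proof (induction n)
  case (Suc n)
  have "(\<lambda>x. record_map x ((record_map x ^^ n) i)) \<in> measurable iid (count_space UNIV)"
    by (rule measurable_compose_countable[OF measurable_record_map Suc])
  then show ?case by simp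
qed simp

section \<open>Consequences of stationarity\<close>

lemma emeasure_iid_shift:
  assumes "A \<in> sets (iid :: (int \<Rightarrow> int) measure)"
  shows "emeasure iid {x. (\<lambda>i. x (i + k)) \<in> A} = emeasure iid A"
proof -
  have "emeasure iid A = emeasure (distr iid iid (\<lambda>x i. x (i + k))) A"
    by (simp add: distr_iid_reindex inj_def)
  also have "\<dots> = emeasure iid {x. (\<lambda>i. x (i + k)) \<in> A}"
    by (simp add: emeasure_distr[OF measurable_reindex assms] vimage_def)
  finally show ?thesis ..
qed

text \<open>Mass transport: the probability that \<open>0\<close> has a parent equals the expected number of
  children of \<open>0\<close>, which is at least the mean of \<open>x (-1) + 1\<close>.\<close>

lemma AE_has_parent: "AE x in iid. \<forall>i. record_map x i \<noteq> i"
proof -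
  interpret iid: prob_space "iid :: (int \<Rightarrow> int) measure" by (rule prob_space_iid)
  \<comment> \<open>Here \<open>n + 1\<close> is the length of a record edge, entering
    \<open>0\<close> in \<open>c n\<close> and leaving \<open>0\<close> in \<open>d n\<close>; a
    shift carries one event to the other.\<close>
  define c where "c n = {x. record_map x (- int n - 1) = 0}" for n
  define d where "d n = {x. record_map x 0 = int n + 1}" for n
  have "{x \<in> space iid. record_map x 0 = int n + 1} \<in> sets iid"
    "{x \<in> space iid. record_map x (- int n - 1) = 0} \<in> sets iid" for n
    by measurable
  then have d_sets: "d n \<in> sets iid" and c_sets: "c n \<in> sets iid" for n
    by (simp_all add: d_def c_def)
  have "c n = {x. (\<lambda>i. x (i + (- int n - 1))) \<in> d n}" for n
    unfolding c_def d_def mem_Collect_eq record_map_shift by auto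
  then have transport: "emeasure iid (c n) = emeasure iid (d n)" for n
    using emeasure_iid_shift[OF d_sets, of "- int n - 1" n] by simp
  \<comment> \<open>There is at most one parent, so the \<open>d n\<close> are disjoint; the
    \<open>c n\<close> need not be, and their indicators add up to the number of children.\<close>
  have disj: "disjoint_family d" by (auto simp: disjoint_family_on_def d_def)
  have card: "AE x in iid. ennreal (real_of_int (x (-1)) + 1) \<le> (\<Sum>n. indicator (c n) x)"
    using AE_iid_ge AE_backward_descent
  proof eventually_elim
    case (elim x)
    \<comment> \<open>Two backward descents from \<open>0\<close> lead to a nonnegative height
      strictly before \<open>-1\<close>, as \<open>card_children_ge\<close> requires.\<close>
    obtain j where j: "j < 0" "0 < height x j" using elim(2) height_0[of x] by metis
    obtain k where k: "k < j" "height x j < height x k" using elim(2) by blast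
    have "\<exists>k < -1. 0 \<le> height x k" using j k by (intro exI[of _ k]) simp
    obtain C where C: "finite C" "C \<subseteq> {i. i < 0 \<and> record_map x i = 0}" "int (card C) = x (-1) + 1"
      using card_children_ge[of x] elim(1) \<open>\<exists>k < -1. 0 \<le> height x k\<close> by blast
    let ?f = "\<lambda>i. nat (- i - 1)"
    have inj: "inj_on ?f C"
    proof (rule inj_onI)
      fix i j assume "i \<in> C" "j \<in> C" "?f i = ?f j"
      then show "i = j" using C(2) by (auto simp: subset_iff nat_eq_iff)
    qed
    have "ennreal (real_of_int (x (-1)) + 1) = of_nat (card C)"
      using C(3) by (metis ennreal_of_nat_eq_real_of_nat of_int_1 of_int_add of_int_of_nat_eq)
    also have "\<dots> = (\<Sum>n\<in>?f ` C. indicator (c n) x)"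
      using C(2) by (subst sum.reindex[OF inj]) (auto simp: c_def subset_iff)
    also have "\<dots> \<le> (\<Sum>n. indicator (c n) x)"
      using C(1) by (intro sum_le_suminf summableI) auto
    finally show ?case .
  qed
  \<comment> \<open>Mean zero makes the expectation of \<open>x (-1) + 1\<close> equal to
    \<open>1\<close>, so the chain forces the probability of having a parent up to
    \<open>1\<close>.\<close>
  have "1 = ennreal (\<integral>y. real_of_int y + 1 \<partial>\<mu>)"
    using integrable_law mean_law by (simp add: prob_space[unfolded space_law])
  also have "\<dots> = (\<integral>\<^sup>+y. ennreal (real_of_int y + 1) \<partial>\<mu>)"
  proof (rule nn_integral_eq_integral[symmetric])
    show "AE y in \<mu>. 0 \<le> real_of_int y + 1" using AE_ge by eventually_elim simp
  qed (use integrable_law in simp)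
  also have "\<dots> = (\<integral>\<^sup>+y. ennreal (real_of_int y + 1) \<partial>distr iid \<mu> (\<lambda>x. x (-1 :: int)))"
    by (simp only: distr_PiM_component[OF prob_space_axioms UNIV_I])
  also have "\<dots> = (\<integral>\<^sup>+x. ennreal (real_of_int (x (-1 :: int)) + 1) \<partial>iid)"
    by (rule nn_integral_distr) (auto intro: measurable_component_singleton simp: measurable_law)
  also have "\<dots> \<le> (\<integral>\<^sup>+x. (\<Sum>n. indicator (c n) x) \<partial>iid)"
    using card by (rule nn_integral_mono_AE)
  also have "\<dots> = (\<Sum>n. emeasure iid (c n))"
    using c_sets by (simp add: nn_integral_suminf)
  also have "\<dots> = (\<Sum>n. emeasure iid (d n))"
    by (simp add: transport)
  also have "\<dots> = emeasure iid (\<Union>n. d n)"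
    using d_sets disj by (intro suminf_emeasure) auto
  finally have "emeasure iid (\<Union>n. d n) = 1"
    using iid.emeasure_le_1 by (metis antisym)
  then have "AE x in iid. x \<in> (\<Union>n. d n)"
    using d_sets by (subst iid.AE_in_set_eq_1) (auto simp: iid.emeasure_eq_measure)
  then have "AE x in iid. record_map x 0 \<noteq> 0"
    by eventually_elim (auto simp: d_def)
  then have "AE x in iid. record_map (\<lambda>j. x (j + i)) 0 \<noteq> 0" for i
    by (intro AE_iid_reindex[where f = "\<lambda>j. j + i" and Q = "\<lambda>x. record_map x 0 \<noteq> 0"])
      (simp_all add: inj_def)
  then show ?thesis
    unfolding AE_all_countable by (simp add: record_map_shift)
qed

lemma first_generation_shift:
  "j \<in> first_generation (record_map (\<lambda>i. x (i + k))) \<longleftrightarrow> j + k \<in> first_generation (record_map x)"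
proof -
  have "earlier_generation (record_map (\<lambda>i. x (i + k))) v w \<longleftrightarrow>
      earlier_generation (record_map x) (v + k) (w + k)" for v w
    by (simp add: earlier_generation_def funpow_record_map_shift)
  then show ?thesis
    unfolding first_generation_def by simp (metis diff_add_cancel)
qed

text \<open>The events that \<open>k\<close> is the least vertex of the first generation are
  disjoint and, by stationarity, equally likely; as there are infinitely many, each is null.\<close>

lemma AE_no_least_in_first_generation:
  "AE x in iid. \<forall>k. k \<in> first_generation (record_map x) \<longrightarrow> (\<exists>j<k. j \<in> first_generation (record_map x))"
proof -
  interpret iid: prob_space "iid :: (int \<Rightarrow> int) measure" by (rule prob_space_iid)
  define E where "E k = {x. k \<in> first_generation (record_map x) \<and>
    (\<forall>j<k. j \<notin> first_generation (record_map x))}" for k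
  have "{x \<in> space iid. k \<in> first_generation (record_map x) \<and>
    (\<forall>j<k. j \<notin> first_generation (record_map x))} \<in> sets iid" for k
    unfolding first_generation_def earlier_generation_def mem_Collect_eq by measurable
  then have E_sets: "E k \<in> sets iid" for k by (simp add: E_def)
  have E_shift: "E k = {x. (\<lambda>i. x (i + k)) \<in> E 0}" for k
  proof -
    have "(\<forall>j<0. j + k \<notin> A) \<longleftrightarrow> (\<forall>j<k. j \<notin> A)" for A :: "int set"
      by (metis add_less_same_cancel2 diff_add_cancel)
    then show ?thesis unfolding E_def mem_Collect_eq first_generation_shift by simp
  qed
  have "emeasure iid (E k) = emeasure iid (E 0)" for k
    using emeasure_iid_shift[OF E_sets, of k 0] by (subst E_shift)
  then have const_fun: "(\<lambda>n. measure iid (E (int n))) = (\<lambda>_. measure iid (E 0))" and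
    const: "measure iid (E k) = measure iid (E 0)" for k
    unfolding measure_def by metis+
  have "disjoint_family (\<lambda>n. E (int n))"
    by (auto simp: disjoint_family_on_def E_def) (metis linorder_neqE_nat of_nat_less_iff)
  then have "summable (\<lambda>n. measure iid (E (int n)))"
    using E_sets by (intro sums_summable[OF iid.finite_measure_UNION]) auto
  then have "measure iid (E 0) = 0"
    by (simp only: const_fun summable_const_iff)
  then have "measure iid (E k) = 0" for k
    using const[of k] by simp
  then have "AE x in iid. x \<notin> E k" for k
    using E_sets[of k] by (intro AE_not_in null_setsI) (simp_all add: iid.emeasure_eq_measure)
  then have "AE x in iid. \<forall>k. x \<notin> E k"
    unfolding AE_all_countable by blast
  then show ?thesis by eventually_elim (auto simp: E_def)
qed

lemma AE_record_graph:
  "AE x in iid. Digraph_Component.connected (record_graph x) \<and>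
     family_tree (weak_component (record_graph x) 0) \<and>
     class_I_I (weak_component (record_graph x) 0)"
  using AE_has_parent AE_backward_descent AE_no_least_in_first_generation
proof eventually_elim
  case (elim x)
  have total: "record_map x i \<noteq> i" for i using elim(1) by blast
  have descendants: "finite {i. \<exists>n. (record_map x ^^ n) i = j}" for j
    using elim(2) finite_descendants by blast
  have connected: "Digraph_Component.connected (record_graph x)"
    using total by (rule connected_record_graph)
  then have "weak_component (record_graph x) 0 = record_graph x"
    by (intro weak_component_of_connected wf_digraph_record_graph) simp_all
  moreover have "family_tree (record_graph x)"
    using total descendants by (rule family_tree_record_graph)
  moreover have "class_I_I (record_graph x)"
    using total descendants elim(3) by (intro class_I_I_record_graph) auto
  ultimately show ?case using connected by simp
qed

end

section \<open>Transfer from the sequence space to the given probability space\<close>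

lemma (in prob_space) skip_free_law_of_increments:
  assumes X: "skip_free_left_increments X"
    and mean: "expectation (\<lambda>\<omega>. real_of_int (X 0 \<omega>)) = 0"
  shows "skip_free_law (distr M (count_space UNIV) (X 0))"
proof -
  have rv: "random_variable (count_space UNIV) (X n)" for n
    using X by (auto simp: skip_free_left_increments_def indep_vars_def)
  interpret law: prob_space "distr M (count_space UNIV) (X 0)"
    by (rule prob_space_distr[OF rv])
  show ?thesis
  proof
    show "AE y in distr M (count_space UNIV) (X 0). -1 \<le> y"
      using X rv by (subst AE_distr_iff) (auto simp: skip_free_left_increments_def)
    have "X 0 -` {-1} \<inter> space M = {\<omega> \<in> space M. X 0 \<omega> = -1}" by auto
    then show "0 < measure (distr M (count_space UNIV) (X 0)) {-1}"
      using X rv by (subst measure_distr) (auto simp: skip_free_left_increments_def)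
    show "integrable (distr M (count_space UNIV) (X 0)) real_of_int"
      using X rv by (subst integrable_distr_eq) (auto simp: skip_free_left_increments_def)
    show "integral\<^sup>L (distr M (count_space UNIV) (X 0)) real_of_int = 0"
      using mean rv by (subst integral_distr) auto
  qed simp
qed

text \<open>Independence makes the joint law the product of the marginals, and these all coincide
  with the law of \<open>X 0\<close>; almost sure statements on sequences thus pull back to
  \<open>M\<close>.\<close>

lemma (in prob_space) distr_increments_eq_PiM:
  assumes "skip_free_left_increments X"
  shows "distr M (PiM UNIV (\<lambda>_. distr M (count_space UNIV) (X 0))) (\<lambda>\<omega> n. X n \<omega>) =
    PiM UNIV (\<lambda>_. distr M (count_space UNIV) (X 0))"
proof -
  have rv: "random_variable (count_space UNIV) (X n)" for n
    using assms by (auto simp: skip_free_left_increments_def indep_vars_def)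
  have "distr M (PiM UNIV (\<lambda>_. count_space UNIV)) (\<lambda>\<omega>. \<lambda>n\<in>UNIV. X n \<omega>) =
      PiM UNIV (\<lambda>n. distr M (count_space UNIV) (X n))"
    using assms indep_vars_iff_distr_eq_PiM[where I = UNIV and M' = "\<lambda>_. count_space UNIV" and X = X] rv
    by (auto simp: skip_free_left_increments_def)
  moreover have "(\<lambda>n. distr M (count_space UNIV) (X n)) = (\<lambda>_. distr M (count_space UNIV) (X 0))"
    using assms by (auto simp: skip_free_left_increments_def)
  moreover have "distr M (PiM UNIV (\<lambda>_. distr M (count_space UNIV) (X 0))) (\<lambda>\<omega> n. X n \<omega>) =
      distr M (PiM UNIV (\<lambda>_. count_space UNIV)) (\<lambda>\<omega>. \<lambda>n\<in>UNIV. X n \<omega>)"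
    by (intro distr_cong sets_PiM_cong) auto
  ultimately show ?thesis by simp
qed

theorem proposition40:
  fixes M :: "'a measure" and X :: "int \<Rightarrow> 'a \<Rightarrow> int"
  assumes "prob_space M"
    and "prob_space.skip_free_left_increments M X"
    and "prob_space.expectation M (\<lambda>\<omega>. real_of_int (X 0 \<omega>)) = 0"
  shows "AE \<omega> in M.
      Digraph_Component.connected (record_graph (\<lambda>n. X n \<omega>)) \<and>
      family_tree (weak_component (record_graph (\<lambda>n. X n \<omega>)) 0) \<and>
      class_I_I (weak_component (record_graph (\<lambda>n. X n \<omega>)) 0)"
proof -
  interpret prob_space M by fact
  define \<mu> where "\<mu> = distr M (count_space UNIV) (X 0)"
  interpret law: skip_free_law \<mu>
    unfolding \<mu>_def using assms(2,3) by (rule skip_free_law_of_increments)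
  have distr: "distr M law.iid (\<lambda>\<omega> n. X n \<omega>) = law.iid"
    unfolding \<mu>_def using assms(2) by (rule distr_increments_eq_PiM)
  have "random_variable (count_space UNIV) (X n)" for n
    using assms(2) by (auto simp: skip_free_left_increments_def indep_vars_def)
  then have "(\<lambda>\<omega> n. X n \<omega>) \<in> measurable M law.iid"
    by (intro measurable_PiM_single') (auto simp: law.space_law measurable_cong_sets[OF refl law.sets_law])
  then show ?thesis
    by (rule AE_distrD) (simp only: distr law.AE_record_graph)
qed

end
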